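(* Let $B$ be either $\mathbb{N}\times\mathbb{N}$ or $\mathbb{Z}\times\mathbb{Z}$, and let $Q$ be the Queen graph on $B$. Then $\alpha_{\mathrm{od}}(Q)=1$.
   Context: Here $\mathbb{N}=\{1,2,3,\ldots\}$. The Queen graph on a board $B\subseteq\mathbb{Z}\times\mathbb{Z}$ has vertex set $B$, and two distinct vertices $(a,b),(a',b')$ are adjacent iff $a=a'$, or $b=b'$, or $a-a'=b-b'$, or $a-a'=b'-b$. For a graph $G=(V,E)$, $N(v)$ denotes the open neighborhood of $v$. A set $S\subseteq V$ (finite or infinite) is an odd independent set if it is independent and, for every vertex $v\in V\setminus S$, the set $N(v)\cap S$ is empty or of odd size. The odd independence number $\alpha_{\mathrm{od}}(G)$ is the largest size of an odd independent set of $G$; thus $\alpha_{\mathrm{od}}(G)=1$ means that $G$ has an odd independent set with exactly one element and that every odd independent set of $G$, finite or infinite, has at most one element. *)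

theory Defs
  imports Main "HOL-Library.Extended_Nat" "HOL-Library.Ramsey"
begin

text \<open>A graph is given by its vertex set \<open>V\<close> and its set \<open>E\<close> of edges, which are two-element
  subsets of \<open>V\<close>. Independence is the predicate \<^const>\<open>indep\<close> of the Ramsey theory.\<close>

definition open_neighborhood :: "'a set set \<Rightarrow> 'a \<Rightarrow> 'a set" where
  "open_neighborhood E v = {w. {v, w} \<in> E}"

text \<open>The cardinality of an infinite set is \<open>0\<close> in HOL, so an infinite \<open>N(v) \<inter> S\<close> is, as it
  should be, neither empty nor of odd size.\<close>

definition odd_independent :: "'a set \<Rightarrow> 'a set set \<Rightarrow> 'a set \<Rightarrow> bool" where
  "odd_independent V E S \<longleftrightarrow> S \<subseteq> V \<and> indep S E \<and>
     (\<forall>v \<in> V - S. open_neighborhood E v \<inter> S = {} \<or> odd (card (open_neighborhood E v \<inter> S)))"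

definition set_size :: "'a set \<Rightarrow> enat" where
  "set_size S = (if finite S then enat (card S) else \<infinity>)"

text \<open>The empty set is odd independent, so the supremum is over a nonempty set of sizes;
  when it is finite it is attained.\<close>

definition odd_independence_number :: "'a set \<Rightarrow> 'a set set \<Rightarrow> enat" where
  "odd_independence_number V E = (SUP S \<in> {S. odd_independent V E S}. set_size S)"

definition queen_adjacent :: "int \<times> int \<Rightarrow> int \<times> int \<Rightarrow> bool" where
  "queen_adjacent p q \<longleftrightarrow> p \<noteq> q \<and>
     (fst p = fst q \<or> snd p = snd q \<or>
      fst p - fst q = snd p - snd q \<or> fst p - fst q = snd q - snd p)"

definition queen_edges :: "(int \<times> int) set \<Rightarrow> (int \<times> int) set set" where
  "queen_edges B = {{p, q} | p q. p \<in> B \<and> q \<in> B \<and> queen_adjacent p q}"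

lemma queen_edges_subset: "queen_edges B \<subseteq> [B]\<^bsup>2\<^esup>"
  by (auto simp: queen_edges_def queen_adjacent_def)

lemma queen_adjacent_sym: "queen_adjacent p q \<longleftrightarrow> queen_adjacent q p"
  unfolding queen_adjacent_def by (auto simp: algebra_simps)

lemma queen_edge_iff: "{p, q} \<in> queen_edges B \<longleftrightarrow> p \<in> B \<and> q \<in> B \<and> queen_adjacent p q"
  unfolding queen_edges_def using queen_adjacent_sym
  by (simp only: mem_Collect_eq doubleton_eq_iff) blast

lemma odd_independence_number_eq_1_iff:
  "odd_independence_number V E = 1 \<longleftrightarrow>
     (\<exists>S. odd_independent V E S \<and> card S = 1) \<and>
     (\<forall>S. odd_independent V E S \<longrightarrow> finite S \<and> card S \<le> 1)"
    (is "?L \<longleftrightarrow> ?A \<and> ?B")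
proof
  assume L: ?L
  have le: "set_size S \<le> 1" if "odd_independent V E S" for S
    using that L unfolding odd_independence_number_def by (metis SUP_upper mem_Collect_eq)
  have B: ?B
  proof (intro allI impI)
    fix S assume "odd_independent V E S"
    from le[OF this] show "finite S \<and> card S \<le> 1"
      by (simp add: set_size_def one_enat_def split: if_splits)
  qed
  have ?A
  proof (rule ccontr)
    assume "\<not> ?A"
    with B have "set_size S \<le> 0" if "odd_independent V E S" for S
      using that by (force simp: set_size_def zero_enat_def le_Suc_eq)
    then have "odd_independence_number V E \<le> 0"
      unfolding odd_independence_number_def by (intro SUP_least) auto
    with L show False by simp
  qed
  with B show "?A \<and> ?B" by blast
next
  assume AB: "?A \<and> ?B"
  then obtain S where S: "odd_independent V E S" "card S = 1" by blast
  have "set_size S = 1"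
    using S AB by (auto simp: set_size_def one_enat_def)
  then have "1 \<le> odd_independence_number V E"
    unfolding odd_independence_number_def using S by (metis SUP_upper mem_Collect_eq)
  moreover have "odd_independence_number V E \<le> 1"
    unfolding odd_independence_number_def using AB
    by (intro SUP_least) (auto simp: set_size_def one_enat_def)
  ultimately show ?L by simp
qed

end

theory Submission
  imports Defs
begin

text \<open>Record an odd independent set by the sets of columns, rows, diagonals and antidiagonals that
  contain one of its queens. Every line carries at most one queen, so an attacked cell without a
  queen lies on an odd number of occupied lines. Seen from a fixed queen, let \<open>c\<close>, \<open>r\<close>, \<open>d\<close>, \<open>a\<close> be
  the indicators modulo 2 of the four families, indexed by the offset from the lines of that queen.
  The cells of its row, column, diagonal and antidiagonal give, for \<open>t \<noteq> 0\<close>,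
  \<open>c(t) = d(t) + a(t)\<close>, \<open>r(t) = d(-t) + a(t)\<close>, \<open>a(2t) = c(t) + r(t) = d(t) + d(-t)\<close> and
  \<open>d(2t) = c(t) + r(-t) = a(t) + a(-t)\<close>. Hence \<open>a(2t)\<close> and \<open>d(2t)\<close> are even functions of \<open>t\<close>, all of
  \<open>a(4t)\<close>, \<open>d(4t)\<close>, \<open>c(4t)\<close>, \<open>r(4t)\<close> vanish, and the set is finite because its lines are distinct
  modulo 4. On the quadrant the cells used must lie on the board, so there this is applied to the rows
  of the queens below the main diagonal and to the columns of those above it. Finally take the queen with the largest antidiagonal. For \<open>t > 0\<close> we have
  \<open>a(t) = 0\<close>, thus \<open>c(t) = d(t) = d(-t)\<close>; a queen with column offset \<open>t\<close> has a negative antidiagonal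
  offset, so its diagonal offset exceeds \<open>2t\<close>. The largest \<open>t\<close> with \<open>d(t) = 1\<close> therefore cannot
  exist: all queens share one diagonal, and there is only one.\<close>

section \<open>Fibres of injective maps and residue classes\<close>

lemma card_fibre_inj_on:
  assumes "inj_on f S"
  shows "card {q \<in> S. f q = k} = of_bool (k \<in> f ` S)"
proof (cases "k \<in> f ` S")
  case True
  then obtain q where "q \<in> S" "k = f q" by blast
  then have "{q \<in> S. f q = k} = {q}" using assms by (auto dest: inj_onD)
  then show ?thesis using True by simp
next
  case False
  then have "{q \<in> S. f q = k} = {}" by blast
  then show ?thesis using False by (simp only: card.empty of_bool_eq)
qed

text \<open>The residues embed \<open>T\<close> into a finite set; by symmetry only pairs with
  \<open>f q < f p\<close> need comparing.\<close>

lemma finite_if_distinct_mod: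
  fixes f :: "'a \<Rightarrow> int"
  assumes inj: "inj_on f T" and "k > 0"
    and mod: "\<And>p q. p \<in> T \<Longrightarrow> q \<in> T \<Longrightarrow> f q < f p \<Longrightarrow> f q mod k \<noteq> f p mod k"
  shows "finite T"
proof (rule inj_on_finite[where B = "{0..<k}"])
  show "inj_on (\<lambda>p. f p mod k) T"
  proof (rule inj_onI)
    fix p q assume pq: "p \<in> T" "q \<in> T" "f p mod k = f q mod k"
    then have "f p = f q" using mod[of p q] mod[of q p] by (cases "f p" "f q" rule: linorder_cases) auto
    with inj pq show "p = q" by (simp add: inj_onD)
  qed
qed (use \<open>k > 0\<close> in auto)

lemma open_neighborhood_queen_edges:
  "z \<in> B \<Longrightarrow> open_neighborhood (queen_edges B) z = {q \<in> B. queen_adjacent z q}"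
  by (simp add: open_neighborhood_def queen_edge_iff)

section \<open>Occupied lines and attackers of an empty cell\<close>

locale odd_queens =
  fixes B S :: "(int \<times> int) set"
  assumes odd_indep: "odd_independent B (queen_edges B) S"
begin

lemma subset_board: "S \<subseteq> B"
  using odd_indep by (simp add: odd_independent_def)

lemma not_adjacent: "p \<in> S \<Longrightarrow> q \<in> S \<Longrightarrow> \<not> queen_adjacent p q"
  using odd_indep subset_board queen_edge_iff[of p q B]
  by (auto simp: odd_independent_def indep_def queen_adjacent_def)

definition "columns = fst ` S"
definition "rows = snd ` S"
definition "diagonals = (\<lambda>p. fst p - snd p) ` S"
definition "antidiagonals = (\<lambda>p. fst p + snd p) ` S"

lemmas line_defs = columns_def rows_def diagonals_def antidiagonals_def

lemma inj_on_lines: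
  "inj_on fst S" "inj_on snd S" "inj_on (\<lambda>p. fst p - snd p) S" "inj_on (\<lambda>p. fst p + snd p) S"
proof -
  have eq: "p = q" if "p \<in> S" "q \<in> S" "fst p = fst q \<or> snd p = snd q \<or>
      fst p - fst q = snd p - snd q \<or> fst p - fst q = snd q - snd p" for p q
    using not_adjacent that unfolding queen_adjacent_def by blast
  show "inj_on fst S" "inj_on snd S" "inj_on (\<lambda>p. fst p - snd p) S" "inj_on (\<lambda>p. fst p + snd p) S"
    by (rule inj_onI, rule eq, assumption, assumption, linarith)+
qed

lemma lines_of_queen:
  assumes "(u, v) \<in> S"
  shows "u \<in> columns" "v \<in> rows" "u - v \<in> diagonals" "u + v \<in> antidiagonals"
  using assms by (force simp: line_defs)+

text \<open>Each of the four lines through the cell carries at most one queen, and two of them meet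
  only in the cell itself, which is empty; so no attacker is counted twice.\<close>

lemma card_attackers:
  assumes "(x, y) \<in> B - S"
  shows "card (open_neighborhood (queen_edges B) (x, y) \<inter> S) =
    of_bool (x \<in> columns) + of_bool (y \<in> rows) +
    of_bool (x - y \<in> diagonals) + of_bool (x + y \<in> antidiagonals)"
proof -
  let ?C = "{q \<in> S. fst q = x}" and ?R = "{q \<in> S. snd q = y}"
  let ?D = "{q \<in> S. fst q - snd q = x - y}" and ?A = "{q \<in> S. fst q + snd q = x + y}"
  have fin: "finite {q \<in> S. f q = k}" if "inj_on f S" for f :: "int \<times> int \<Rightarrow> int" and k
    using finite_vimage_IntI[OF _ that, of "{k}"] by (simp add: vimage_def Int_def conj_commute)
  have meet: "a = x \<and> b = y" if "a + b = x + y" "a - b = x - y" for a b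
    using that by presburger
  have "open_neighborhood (queen_edges B) (x, y) \<inter> S = ?C \<union> ?R \<union> ?D \<union> ?A"
    using assms subset_board
    by (auto simp: open_neighborhood_queen_edges queen_adjacent_def)
  moreover have "?C \<inter> ?R = {}" "(?C \<union> ?R) \<inter> ?D = {}" "(?C \<union> ?R \<union> ?D) \<inter> ?A = {}"
    using assms by (auto dest: meet)
  ultimately have "card (open_neighborhood (queen_edges B) (x, y) \<inter> S) =
      card ?C + card ?R + card ?D + card ?A"
    using inj_on_lines by (simp add: card_Un_disjoint fin)
  then show ?thesis
    by (simp only: card_fibre_inj_on[OF inj_on_lines(1)] card_fibre_inj_on[OF inj_on_lines(2)]
      card_fibre_inj_on[OF inj_on_lines(3)] card_fibre_inj_on[OF inj_on_lines(4)] line_defs)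
qed

lemma odd_occupied_lines:
  assumes "(x, y) \<in> B - S"
    and "x \<in> columns \<or> y \<in> rows \<or> x - y \<in> diagonals \<or> x + y \<in> antidiagonals"
  shows "odd (of_bool (x \<in> columns) + of_bool (y \<in> rows) +
    of_bool (x - y \<in> diagonals) + of_bool (x + y \<in> antidiagonals) :: nat)"
proof -
  let ?N = "open_neighborhood (queen_edges B) (x, y) \<inter> S"
  have "card ?N \<noteq> 0"
    using assms(2) by (auto simp: card_attackers[OF assms(1)])
  then have "odd (card ?N)"
    using odd_indep assms(1) unfolding odd_independent_def by (metis card.empty)
  then show ?thesis
    by (simp add: card_attackers[OF assms(1)])
qed

section \<open>Parity relations along the four lines of a queen\<close>

lemma row_parity:
  assumes "(u, v) \<in> S" "t \<noteq> 0" "(u + t, v) \<in> B"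
  shows "u + t \<in> columns \<longleftrightarrow> (u - v + t \<in> diagonals \<longleftrightarrow> u + v + t \<notin> antidiagonals)"
proof -
  have "(u + t, v) \<notin> S"
    using inj_onD[OF inj_on_lines(2), of "(u + t, v)" "(u, v)"] assms by auto
  \<comment> \<open>The queen's own row is one of an odd number of occupied lines, so the other
    three indicators have even sum.\<close>
  then show ?thesis
    using odd_occupied_lines[of "u + t" v] lines_of_queen[OF assms(1)] assms
    by (auto simp: algebra_simps split: if_splits)
qed

lemma column_parity:
  assumes "(u, v) \<in> S" "t \<noteq> 0" "(u, v + t) \<in> B"
  shows "v + t \<in> rows \<longleftrightarrow> (u - v - t \<in> diagonals \<longleftrightarrow> u + v + t \<notin> antidiagonals)"
proof -
  have "(u, v + t) \<notin> S"
    using inj_onD[OF inj_on_lines(1), of "(u, v + t)" "(u, v)"] assms by auto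
  then show ?thesis
    using odd_occupied_lines[of u "v + t"] lines_of_queen[OF assms(1)] assms
    by (auto simp: algebra_simps split: if_splits)
qed

lemma diagonal_parity:
  assumes "(u, v) \<in> S" "t \<noteq> 0" "(u + t, v + t) \<in> B"
  shows "u + v + 2 * t \<in> antidiagonals \<longleftrightarrow> (u + t \<in> columns \<longleftrightarrow> v + t \<notin> rows)"
proof -
  have "(u + t, v + t) \<notin> S"
    using inj_onD[OF inj_on_lines(3), of "(u + t, v + t)" "(u, v)"] assms by auto
  then show ?thesis
    using odd_occupied_lines[of "u + t" "v + t"] lines_of_queen[OF assms(1)] assms
    by (auto simp: algebra_simps split: if_splits)
qed

lemma antidiagonal_parity:
  assumes "(u, v) \<in> S" "t \<noteq> 0" "(u + t, v - t) \<in> B"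
  shows "u - v + 2 * t \<in> diagonals \<longleftrightarrow> (u + t \<in> columns \<longleftrightarrow> v - t \<notin> rows)"
proof -
  have "(u + t, v - t) \<notin> S"
    using inj_onD[OF inj_on_lines(4), of "(u + t, v - t)" "(u, v)"] assms by auto
  then show ?thesis
    using odd_occupied_lines[of "u + t" "v - t"] lines_of_queen[OF assms(1)] assms
    by (auto simp: algebra_simps split: if_splits)
qed

section \<open>Distinct residues modulo 4 and finiteness\<close>

lemma no_line_at_distance_4s:
  assumes q: "(u, v) \<in> S" and s: "s > 0"
    and box: "\<And>x y. \<bar>x\<bar> \<le> 4 * s \<Longrightarrow> \<bar>y\<bar> \<le> 4 * s \<Longrightarrow> (u + x, v + y) \<in> B"
  shows "u - 4 * s \<notin> columns" "v - 4 * s \<notin> rows"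
proof -
  have row: "u + t \<in> columns \<longleftrightarrow> (u - v + t \<in> diagonals \<longleftrightarrow> u + v + t \<notin> antidiagonals)"
    and col: "v + t \<in> rows \<longleftrightarrow> (u - v - t \<in> diagonals \<longleftrightarrow> u + v + t \<notin> antidiagonals)"
    and dia: "u + v + 2 * t \<in> antidiagonals \<longleftrightarrow> (u + t \<in> columns \<longleftrightarrow> v + t \<notin> rows)"
    and ant: "u - v + 2 * t \<in> diagonals \<longleftrightarrow> (u + t \<in> columns \<longleftrightarrow> v - t \<notin> rows)"
    if "t \<noteq> 0" "\<bar>t\<bar> \<le> 4 * s" for t
    using that box[of t 0] box[of 0 t] box[of t t] box[of t "- t"]
      row_parity[OF q, of t] column_parity[OF q, of t]
      diagonal_parity[OF q, of t] antidiagonal_parity[OF q, of t] s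
    by simp_all
  \<comment> \<open>Adding the row and column relations at \<open>t\<close> cancels the antidiagonal
    at \<open>t\<close>.\<close>
  have A: "u + v + 2 * t \<in> antidiagonals \<longleftrightarrow> (u - v + t \<in> diagonals \<longleftrightarrow> u - v - t \<notin> diagonals)"
    if "t \<noteq> 0" "\<bar>t\<bar> \<le> 4 * s" for t
    using row[OF that] col[OF that] dia[OF that] by blast
  \<comment> \<open>Here the column relation is taken at \<open>- t\<close>, so that the diagonal at
    \<open>t\<close> cancels.\<close>
  have D: "u - v + 2 * t \<in> diagonals \<longleftrightarrow> (u + v + t \<in> antidiagonals \<longleftrightarrow> u + v - t \<notin> antidiagonals)"
    if "t \<noteq> 0" "\<bar>t\<bar> \<le> 4 * s" for t
    using row[OF that] col[of "- t"] ant[OF that] that by auto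
  \<comment> \<open>\<open>D\<close> at \<open>s\<close> and \<open>- s\<close> has the same
    right-hand side, so the diagonals at offsets \<open>2 * s\<close> and \<open>- 2 * s\<close>
    cancel in \<open>A\<close>.\<close>
  have "u + v - 4 * s \<notin> antidiagonals"
    using A[of "- 2 * s"] D[of s] D[of "- s"] s by auto
  moreover have "u - v + 4 * s \<notin> diagonals" "u - v - 4 * s \<notin> diagonals"
    using D[of "2 * s"] D[of "- 2 * s"] A[of s] A[of "- s"] s by auto
  ultimately show "u - 4 * s \<notin> columns" "v - 4 * s \<notin> rows"
    using row[of "- 4 * s"] col[of "- 4 * s"] s by auto
qed

lemma finite_queens:
  assumes B: "B = {1..} \<times> {1..} \<or> B = UNIV \<times> UNIV"
  shows "finite S"
proof -
  have box: "(u + x, v + y) \<in> B"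
    if "(u, v) \<in> B" "\<bar>x\<bar> < u \<and> \<bar>y\<bar> < v \<or> B = UNIV \<times> UNIV" for u v x y
    using that B by auto
  have "snd q mod 4 \<noteq> snd p mod 4"
    if pq: "p \<in> S" "q \<in> S" "snd p \<le> fst p" "snd q < snd p" for p q
  proof
    assume "snd q mod 4 = snd p mod 4"
    then have "4 dvd snd p - snd q" by (simp add: mod_eq_dvd_iff dvd_diff_commute)
    then obtain s where s: "snd p - snd q = 4 * s" by auto
    have "snd p - 4 * s \<notin> rows"
    proof (rule no_line_at_distance_4s)
      show "(fst p, snd p) \<in> S" "s > 0" using pq s by auto
      \<comment> \<open>On the quadrant \<open>snd q \<ge> 1\<close>, so
        \<open>4 * s < snd p \<le> fst p\<close> and the box fits on the board.\<close>
      show "(fst p + x, snd p + y) \<in> B" if "\<bar>x\<bar> \<le> 4 * s" "\<bar>y\<bar> \<le> 4 * s" for x y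
        using B that pq s subset_board by - (rule box, auto)
    qed
    moreover have "snd p - 4 * s = snd q" using s by simp
    ultimately show False using pq(2) by (simp add: rows_def)
  qed
  then have lower: "finite {p \<in> S. snd p \<le> fst p}"
    by (intro finite_if_distinct_mod[of snd _ 4] inj_on_subset[OF inj_on_lines(2)]) auto
  have "fst q mod 4 \<noteq> fst p mod 4"
    if pq: "p \<in> S" "q \<in> S" "fst p \<le> snd p" "fst q < fst p" for p q
  proof
    assume "fst q mod 4 = fst p mod 4"
    then have "4 dvd fst p - fst q" by (simp add: mod_eq_dvd_iff dvd_diff_commute)
    then obtain s where s: "fst p - fst q = 4 * s" by auto
    have "fst p - 4 * s \<notin> columns"
    proof (rule no_line_at_distance_4s)
      show "(fst p, snd p) \<in> S" "s > 0" using pq s by auto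
      show "(fst p + x, snd p + y) \<in> B" if "\<bar>x\<bar> \<le> 4 * s" "\<bar>y\<bar> \<le> 4 * s" for x y
        using B that pq s subset_board by - (rule box, auto)
    qed
    moreover have "fst p - 4 * s = fst q" using s by simp
    ultimately show False using pq(2) by (simp add: columns_def)
  qed
  then have upper: "finite {p \<in> S. fst p \<le> snd p}"
    by (intro finite_if_distinct_mod[of fst _ 4] inj_on_subset[OF inj_on_lines(1)]) auto
  show ?thesis
    by (rule finite_subset[OF _ finite_UnI[OF lower upper]]) auto
qed

section \<open>A finite set has at most one queen\<close>

lemma card_queens_le_1:
  assumes quadrant: "\<And>x y x' y'. (x, y) \<in> B \<Longrightarrow> x \<le> x' \<Longrightarrow> y \<le> y' \<Longrightarrow> (x', y') \<in> B"
    and fin: "finite S"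
  shows "card S \<le> 1"
proof (cases "S = {}")
  case False
  then have ne: "antidiagonals \<noteq> {}" and finA: "finite antidiagonals"
    using fin by (simp_all add: antidiagonals_def)
  obtain u v where q: "(u, v) \<in> S" and max: "u + v = Max antidiagonals"
    using Max_in[OF finA ne] unfolding antidiagonals_def by auto
  have A: "k \<le> u + v" if "k \<in> antidiagonals" for k
    using Max_ge[OF finA that] max by simp
  \<comment> \<open>Only cells to the right of and above the queen are used, so both boards are
    covered.\<close>
  have shift: "(u + t, v) \<in> B" "(u, v + t) \<in> B" "(u + t, v + t) \<in> B" if "t > 0" for t
    using quadrant[of u v] q subset_board that by auto
  have eqs: "u + t \<in> columns \<longleftrightarrow> u - v + t \<in> diagonals"
    "u - v + t \<in> diagonals \<longleftrightarrow> u - v - t \<in> diagonals" if t: "t > 0" for t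
  proof -
    have "u + v + t \<notin> antidiagonals" "u + v + 2 * t \<notin> antidiagonals"
      using A t by (smt (verit))+
    then show "u + t \<in> columns \<longleftrightarrow> u - v + t \<in> diagonals"
      "u - v + t \<in> diagonals \<longleftrightarrow> u - v - t \<in> diagonals"
      using row_parity[OF q _ shift(1)[OF t]] column_parity[OF q _ shift(2)[OF t]]
        diagonal_parity[OF q _ shift(3)[OF t]] t by auto
  qed
  have finD: "finite diagonals" using fin by (simp add: diagonals_def)
  have D_le: "Max diagonals \<le> u - v"
  proof (rule ccontr)
    define t where "t = Max diagonals - (u - v)"
    assume "\<not> ?thesis"
    then have t: "t > 0" by (simp add: t_def)
    have "u - v + t \<in> diagonals"
      using Max_in[OF finD] lines_of_queen(3)[OF q] by (auto simp: t_def)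
    then have "u + t \<in> columns" using eqs(1)[OF t] by simp
    \<comment> \<open>Maximality of \<open>u + v\<close> forces \<open>y \<le> v - t\<close>, so
      this queen has diagonal at least \<open>u - v + 2 * t\<close>, beyond the maximum
      \<open>u - v + t\<close>.\<close>
    then obtain y where y: "(u + t, y) \<in> S" by (auto simp: columns_def)
    have "u + t + y \<le> u + v" using A lines_of_queen(4)[OF y] by simp
    moreover have "u + t - y \<le> Max diagonals"
      using finD lines_of_queen(3)[OF y] by simp
    ultimately show False using t by (simp add: t_def)
  qed
  have "diagonals \<subseteq> {u - v}"
  proof
    fix k assume k: "k \<in> diagonals"
    then have "k \<le> u - v" using Max_ge[OF finD] D_le by fastforce
    moreover have "\<not> k < u - v"
    proof
      assume "k < u - v"
      \<comment> \<open>Reflecting \<open>k\<close> in \<open>u - v\<close> gives a diagonal above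
        the maximum.\<close>
      then have "u - v + (u - v - k) \<in> diagonals"
        using eqs(2)[of "u - v - k"] k by simp
      then show False using Max_ge[OF finD] D_le \<open>k < u - v\<close> by fastforce
    qed
    ultimately show "k \<in> {u - v}" by simp
  qed
  then have "card diagonals \<le> 1" by (metis card.empty card_insert_disjoint card_mono empty_iff
    finite.emptyI finite.insertI One_nat_def)
  then show ?thesis
    by (simp add: diagonals_def card_image inj_on_lines(3))
qed simp

end

section \<open>Singletons and the value of the odd independence number\<close>

lemma odd_independent_singleton:
  assumes "p \<in> B"
  shows "odd_independent B (queen_edges B) {p}"
proof -
  have "odd (card (N \<inter> {p}))" if "N \<inter> {p} \<noteq> {}" for N
    using that by (cases "p \<in> N") auto
  then show ?thesis
    using assms by (auto simp: odd_independent_def indep_def queen_edges_def queen_adjacent_def)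
qed

theorem corollary12:
  fixes B :: "(int \<times> int) set"
  assumes "B = {1..} \<times> {1..} \<or> B = UNIV \<times> UNIV"
  shows "odd_independence_number B (queen_edges B) = 1"
  unfolding odd_independence_number_eq_1_iff
proof (intro conjI allI impI exI)
  show "odd_independent B (queen_edges B) {(1, 1)}"
    using assms by (intro odd_independent_singleton) auto
  show "card {(1, 1)} = 1" by simp
next
  fix S assume "odd_independent B (queen_edges B) S"
  then interpret odd_queens B S by unfold_locales
  show fin: "finite S" using finite_queens assms by blast
  show "card S \<le> 1" using assms fin by (intro card_queens_le_1) auto
qed

end
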